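(* Let $c>0$, $\gamma\ge2$, $V'(x)=x^{\gamma-1}$, $V(x)=x^\gamma/\gamma$. Let $(\mathbf U,\rho)$, with $\rho\ge0$, be a solution of $$\mathbf U^\alpha\mathbf D_\alpha\mathbf U_\beta+\mathbf D_\beta V'(\rho)=0,\qquad \mathbf U^\alpha\mathbf D_\alpha\rho+\rho\,\mathbf D_\alpha\mathbf U^\alpha=0,\qquad \mathbf U^\alpha\mathbf U_\alpha+2V'(\rho)=-c^2 .$$ Define $$\Gamma=\frac{1}{\sqrt{1+\frac{2V'(\rho)}{c^2}}},\qquad \mu=\rho+\frac{(\gamma+1)V(\rho)}{c^2},\qquad \mathbf u=\Gamma\,\mathbf U,\qquad p=(\gamma-1)V(\rho).$$ Then $(\mathbf u,\mu,p)$ is a solution of the relativistic barotropic Euler system $$\mathbf u^\alpha\mathbf D_\alpha\mathbf u^\beta+\Big(g^{\alpha\beta}+\frac{\mathbf u^\alpha\mathbf u^\beta}{c^2}\Big)\frac{\mathbf D_\alpha p}{\mu+\frac p{c^2}}=0,\qquad \mathbf u^\alpha\mathbf D_\alpha\mu+\Big(\mu+\frac p{c^2}\Big)\mathbf D_\alpha\mathbf u^\alpha=0,\qquad p=p(\mu),\qquad \mathbf u^\alpha\mathbf u_\alpha=-c^2 .$$ Moreover $$\mathbf J:=\rho\,\mathbf U=\Gamma\Big(\mu+\frac p{c^2}\Big)\mathbf u,\qquad \rho=\Gamma^2\Big(\mu+\frac p{c^2}\Big).$$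
   Context: The spacetime is $\mathbb R^{1+3}$ with Minkowski metric $g=\mathrm{diag}(-c^2,1,1,1)$, where $c$ is the speed of light. Indices are raised and lowered with $g$ and repeated Greek indices are summed over $0,\dots,3$. $\mathbf D_0=\partial_t$, $\mathbf D_i=\partial_{x^i}$. Solutions are understood in the classical sense. "$p=p(\mu)$" means that $p$ is a function of $\mu$. Where $\mu+p/c^2=0$ (equivalently $\rho=0$), the quotient $\mathbf D_\alpha p/(\mu+p/c^2)$ is understood as $\mathbf D_\alpha V'(\rho)/(1+2V'(\rho)/c^2)$, to which it is equal where $\rho>0$. *)

theory Defs
  imports "HOL-Analysis.Analysis"
begin

text \<open>
  Points of spacetime and contravariant vectors are elements of \<^typ>\<open>real ^ 4\<close>. The index type
  \<^typ>\<open>4\<close> is the integers modulo 4, so its elements are 0, 1, 2, 3 and the time index is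
  \<^term>\<open>0 :: 4\<close> (which equals \<^term>\<open>4 :: 4\<close>).
\<close>

definition minkowski :: "real \<Rightarrow> real ^ 4 ^ 4" where
  "minkowski c = (\<chi> \<alpha> \<beta>. if \<alpha> = \<beta> then (if \<alpha> = 0 then - (c\<^sup>2) else 1) else 0)"

definition lower :: "real \<Rightarrow> real ^ 4 \<Rightarrow> real ^ 4" where
  "lower c v = (\<chi> \<beta>. \<Sum>\<alpha>\<in>UNIV. minkowski c $ \<beta> $ \<alpha> * v $ \<alpha>)"

definition D :: "4 \<Rightarrow> (real ^ 4 \<Rightarrow> 'b::real_normed_vector) \<Rightarrow> real ^ 4 \<Rightarrow> 'b" where
  "D \<alpha> f x = frechet_derivative f (at x) (axis \<alpha> 1)"

definition C1_on :: "(real ^ 4) set \<Rightarrow> (real ^ 4 \<Rightarrow> 'b::real_normed_vector) \<Rightarrow> bool" where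
  "C1_on \<Omega> f \<longleftrightarrow>
     (\<forall>x\<in>\<Omega>. f differentiable (at x)) \<and> (\<forall>\<alpha>. continuous_on \<Omega> (D \<alpha> f))"

text \<open>
  Classical solutions on \<open>\<Omega>\<close> of the system for \<open>(U, \<rho>)\<close>; the argument \<open>V'\<close> is a function of
  one real variable and \<^term>\<open>U x $ \<alpha>\<close> is the contravariant component.
\<close>

definition potential_euler_solution ::
  "real \<Rightarrow> (real \<Rightarrow> real) \<Rightarrow> (real ^ 4) set \<Rightarrow> (real ^ 4 \<Rightarrow> real ^ 4) \<Rightarrow> (real ^ 4 \<Rightarrow> real) \<Rightarrow> bool"
where
  "potential_euler_solution c V' \<Omega> U \<rho> \<longleftrightarrow>
     C1_on \<Omega> U \<and> C1_on \<Omega> \<rho> \<and>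
     (\<forall>x\<in>\<Omega>.
        (\<forall>\<beta>. (\<Sum>\<alpha>\<in>UNIV. U x $ \<alpha> * D \<alpha> (\<lambda>y. lower c (U y) $ \<beta>) x)
              + D \<beta> (\<lambda>y. V' (\<rho> y)) x = 0) \<and>
        (\<Sum>\<alpha>\<in>UNIV. U x $ \<alpha> * D \<alpha> \<rho> x) + \<rho> x * (\<Sum>\<alpha>\<in>UNIV. D \<alpha> (\<lambda>y. U y $ \<alpha>) x) = 0 \<and>
        (\<Sum>\<alpha>\<in>UNIV. U x $ \<alpha> * lower c (U x) $ \<alpha>) + 2 * V' (\<rho> x) = - (c\<^sup>2))"

text \<open>
  Classical solutions on \<open>\<Omega>\<close> of the relativistic barotropic Euler system. The quotient
  \<open>D\<^sub>\<alpha> p / (\<mu> + p/c\<^sup>2)\<close> has no meaning of its own where its denominator vanishes; there it is read as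
  \<^term>\<open>Q \<alpha> x\<close>, and the argument \<open>Q\<close> has no effect anywhere else.
\<close>

definition barotropic_euler_solution ::
  "real \<Rightarrow> (4 \<Rightarrow> real ^ 4 \<Rightarrow> real) \<Rightarrow> (real ^ 4) set \<Rightarrow>
   (real ^ 4 \<Rightarrow> real ^ 4) \<Rightarrow> (real ^ 4 \<Rightarrow> real) \<Rightarrow> (real ^ 4 \<Rightarrow> real) \<Rightarrow> bool"
where
  "barotropic_euler_solution c Q \<Omega> u \<mu> p \<longleftrightarrow>
     C1_on \<Omega> u \<and> C1_on \<Omega> \<mu> \<and> C1_on \<Omega> p \<and>
     (\<forall>x\<in>\<Omega>.
        (\<forall>\<beta>. (\<Sum>\<alpha>\<in>UNIV. u x $ \<alpha> * D \<alpha> (\<lambda>y. u y $ \<beta>) x)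
              + (\<Sum>\<alpha>\<in>UNIV. (matrix_inv (minkowski c) $ \<alpha> $ \<beta> + u x $ \<alpha> * u x $ \<beta> / c\<^sup>2)
                  * (if \<mu> x + p x / c\<^sup>2 = 0 then Q \<alpha> x else D \<alpha> p x / (\<mu> x + p x / c\<^sup>2))) = 0) \<and>
        (\<Sum>\<alpha>\<in>UNIV. u x $ \<alpha> * D \<alpha> \<mu> x)
          + (\<mu> x + p x / c\<^sup>2) * (\<Sum>\<alpha>\<in>UNIV. D \<alpha> (\<lambda>y. u y $ \<alpha>) x) = 0 \<and>
        (\<Sum>\<alpha>\<in>UNIV. u x $ \<alpha> * lower c (u x) $ \<alpha>) = - (c\<^sup>2)) \<and>
     (\<exists>P :: real \<Rightarrow> real. \<forall>x\<in>\<Omega>. p x = P (\<mu> x))"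

end

theory Submission
  imports Defs
begin

text \<open>
  Put \<open>h = V'(\<rho>)\<close> and \<open>W = 1 + 2 h / c\<^sup>2 = \<Gamma>\<^sup>-\<^sup>2\<close>. Everything reduces to the pointwise identities
  \<open>\<mu> + p / c\<^sup>2 = \<rho> W\<close>, \<open>D p = \<rho> D h = (\<gamma> - 1) h D \<rho>\<close>, \<open>D \<mu> = (1 + (\<gamma> + 1) h / c\<^sup>2) D \<rho>\<close> and
  \<open>D \<Gamma> = - \<Gamma>\<^sup>3 D h / c\<^sup>2\<close>. These also hold on the vacuum set: powers \<open>t powr a\<close> with \<open>a \<ge> 1\<close> are
  continuously differentiable up to \<open>t = 0\<close> from the right, and \<open>\<rho>\<close> only takes values \<open>\<ge> 0\<close>.
  Since \<open>\<rho> \<mapsto> \<mu>\<close> is strictly increasing on \<open>\<rho> \<ge> 0\<close>, the pressure is a function of \<open>\<mu>\<close>.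
\<close>

section \<open>Calculus of continuously differentiable fields\<close>

lemma D_eqI:
  assumes "(f has_derivative f') (at x)"
  shows "D \<alpha> f x = f' (axis \<alpha> 1)"
  using frechet_derivative_at[OF assms] by (simp add: D_def)

lemma C1_on_has_derivative:
  assumes "C1_on \<Omega> f" "x \<in> \<Omega>"
  shows "(f has_derivative frechet_derivative f (at x)) (at x)"
  using assms by (simp add: C1_on_def frechet_derivative_works)

lemma C1_on_continuous_on:
  assumes "C1_on \<Omega> f"
  shows "continuous_on \<Omega> f"
  using C1_on_has_derivative[OF assms] has_derivative_continuous
  by (meson continuous_at_imp_continuous_on)

lemma C1_on_continuous_on_D:
  assumes "C1_on \<Omega> f"
  shows "continuous_on \<Omega> (D \<alpha> f)"
  using assms by (simp add: C1_on_def)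

lemma C1_onI:
  assumes "\<And>x. x \<in> \<Omega> \<Longrightarrow> (f has_derivative f' x) (at x)"
    and "\<And>\<alpha>. continuous_on \<Omega> (\<lambda>x. f' x (axis \<alpha> 1))"
  shows "C1_on \<Omega> f"
  unfolding C1_on_def
proof (intro conjI ballI allI)
  show "f differentiable at x" if "x \<in> \<Omega>" for x
    using assms(1)[OF that] by (auto simp: differentiable_def)
  show "continuous_on \<Omega> (D \<alpha> f)" for \<alpha>
    using assms(2)[of \<alpha>] D_eqI[OF assms(1)] by (simp cong: continuous_on_cong)
qed

lemma D_component:
  assumes "C1_on \<Omega> f" "x \<in> \<Omega>"
  shows "D \<alpha> (\<lambda>y. f y $ \<beta>) x = D \<alpha> f x $ \<beta>"
  by (subst D_eqI[OF bounded_linear.has_derivative[OF bounded_linear_vec_nth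
        C1_on_has_derivative[OF assms]]]) (simp add: D_def)

lemma
  assumes f: "C1_on \<Omega> f" and g: "C1_on \<Omega> g"
  shows C1_on_scaleR: "C1_on \<Omega> (\<lambda>x. f x *\<^sub>R g x)"
    and D_scaleR: "x \<in> \<Omega> \<Longrightarrow> D \<alpha> (\<lambda>x. f x *\<^sub>R g x) x = f x *\<^sub>R D \<alpha> g x + D \<alpha> f x *\<^sub>R g x"
proof -
  note der = has_derivative_scaleR[OF C1_on_has_derivative[OF f] C1_on_has_derivative[OF g]]
  show "D \<alpha> (\<lambda>x. f x *\<^sub>R g x) x = f x *\<^sub>R D \<alpha> g x + D \<alpha> f x *\<^sub>R g x" if "x \<in> \<Omega>"
    by (subst D_eqI[OF der[OF that that]]) (simp add: D_def)
  have "continuous_on \<Omega> (\<lambda>x. f x *\<^sub>R D \<alpha> g x + D \<alpha> f x *\<^sub>R g x)" for \<alpha>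
    by (intro continuous_intros C1_on_continuous_on C1_on_continuous_on_D f g)
  then show "C1_on \<Omega> (\<lambda>x. f x *\<^sub>R g x)"
    by (intro C1_onI[OF der]) (auto simp: D_def)
qed

text \<open>The derivative of \<open>g\<close> is required only within the image of
  \<open>f\<close>, so a one-sided derivative suffices at a boundary value. This is what makes the
  chain rule usable where the density touches 0. Openness of \<Omega> turns the resulting derivative
  within \<Omega> into a full derivative at \<open>x\<close>.\<close>

lemma
  fixes f :: "real ^ 4 \<Rightarrow> real"
  assumes "open \<Omega>" and f: "C1_on \<Omega> f"
    and g: "\<And>x. x \<in> \<Omega> \<Longrightarrow> (g has_real_derivative g' (f x)) (at (f x) within f ` \<Omega>)"
    and g': "continuous_on (f ` \<Omega>) g'"
  shows C1_on_compose_real: "C1_on \<Omega> (\<lambda>x. g (f x))"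
    and D_compose_real: "x \<in> \<Omega> \<Longrightarrow> D \<alpha> (\<lambda>x. g (f x)) x = g' (f x) * D \<alpha> f x"
proof -
  have der: "((\<lambda>x. g (f x)) has_derivative (\<lambda>v. g' (f x) * frechet_derivative f (at x) v)) (at x)"
    if "x \<in> \<Omega>" for x
    using has_derivative_in_compose[OF has_derivative_at_withinI[OF C1_on_has_derivative[OF f that]]
        g[OF that, unfolded has_field_derivative_def]] at_within_open[OF that \<open>open \<Omega>\<close>]
    by simp
  show "D \<alpha> (\<lambda>x. g (f x)) x = g' (f x) * D \<alpha> f x" if "x \<in> \<Omega>"
    by (subst D_eqI[OF der[OF that]]) (simp add: D_def)
  have "continuous_on \<Omega> (\<lambda>x. g' (f x) * D \<alpha> f x)" for \<alpha>
    by (intro continuous_intros continuous_on_compose2[OF g'] C1_on_continuous_on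
        C1_on_continuous_on_D f) auto
  then show "C1_on \<Omega> (\<lambda>x. g (f x))"
    by (intro C1_onI[OF der]) (auto simp: D_def)
qed

section \<open>Powers on the closed half line\<close>

text \<open>The case distinction is needed because \<^term>\<open>0 powr 0 = (0 :: real)\<close>.\<close>

definition powr_deriv :: "real \<Rightarrow> real \<Rightarrow> real" where
  "powr_deriv a t = (if a = 1 then 1 else a * t powr (a - 1))"

text \<open>The factor \<open>t\<close> makes both sides vanish at \<open>t = 0\<close>, so this
  form needs no case distinction for the vacuum or for \<open>a = 1\<close>.\<close>

lemma mult_powr_deriv:
  assumes "t \<ge> 0"
  shows "t * powr_deriv a t = a * t powr a"
proof (cases "t = 0")
  case False
  then show ?thesis
    using assms by (simp add: powr_deriv_def powr_diff)
qed simp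

lemma continuous_on_powr_deriv:
  assumes "a \<ge> 1" "S \<subseteq> {0..}"
  shows "continuous_on S (powr_deriv a)"
proof (cases "a = 1")
  case False
  with assms show ?thesis
    by (auto simp: powr_deriv_def[abs_def] intro!: continuous_intros continuous_on_powr')
qed (simp add: powr_deriv_def[abs_def])

text \<open>Only \<open>t = 0\<close> differs from the usual power rule. For \<open>a > 1\<close>
  the difference quotient there is \<open>s powr (a - 1)\<close>, which tends to 0 from the right;
  for \<open>a = 1\<close> the power is the identity on the half line.\<close>

lemma has_real_derivative_powr_nonneg:
  assumes "a \<ge> 1" "t \<ge> 0" "S \<subseteq> {0..}"
  shows "((\<lambda>t. t powr a) has_real_derivative powr_deriv a t) (at t within S)"
proof (rule DERIV_subset[OF _ assms(3)])
  consider "t > 0" | "t = 0" "a > 1" | "t = 0" "a = 1"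
    using assms by linarith
  then show "((\<lambda>t. t powr a) has_real_derivative powr_deriv a t) (at t within {0..})"
  proof cases
    case 1
    then show ?thesis
      using has_real_derivative_powr[of t a] has_field_derivative_at_within
      by (auto simp: powr_deriv_def)
  next
    case 2
    have "((\<lambda>s::real. s powr (a - 1)) \<longlongrightarrow> 0) (at 0 within {0..})"
    proof -
      have "continuous_on {0..} (\<lambda>s::real. s powr (a - 1))"
        using 2 by (intro continuous_on_powr' continuous_intros) auto
      then show ?thesis
        by (auto simp: continuous_on_def dest: bspec[of _ _ 0])
    qed
    moreover have "\<forall>\<^sub>F s::real in at 0 within {0..}. s powr (a - 1) = (s powr a - 0 powr a) / (s - 0)"
      by (auto simp: eventually_at_filter powr_diff)
    ultimately show ?thesis
      using 2 by (simp add: has_field_derivative_iff powr_deriv_def tendsto_cong)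
  next
    case 3
    have "((\<lambda>t. t) has_real_derivative 1) (at t within {0..})"
      by (rule DERIV_ident)
    then have "((\<lambda>t. t powr 1) has_real_derivative 1) (at t within {0..})"
      by (rule has_field_derivative_transform_within[where d = 1]) (use 3 in auto)
    with 3 show ?thesis
      by (simp add: powr_deriv_def)
  qed
qed

section \<open>The metric and its inverse\<close>

text \<open>Since \<open>matrix_inv\<close> is defined by Hilbert choice, \<open>B\<close> first
  serves as witness that the chosen matrix is an inverse at all; uniqueness of inverses then
  identifies the two.\<close>

lemma matrix_inv_unique:
  fixes A B :: "real ^ 'n ^ 'n"
  assumes "A ** B = mat 1" "B ** A = mat 1"
  shows "matrix_inv A = B"
proof -
  have "A ** matrix_inv A = mat 1"
    unfolding matrix_inv_def by (rule someI2[of _ B]) (use assms in auto)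
  then show ?thesis
    using assms(2) by (metis matrix_mul_assoc matrix_mul_lid matrix_mul_rid)
qed

lemma minkowski_inv:
  assumes "c \<noteq> 0"
  shows "matrix_inv (minkowski c) =
    (\<chi> \<alpha> \<beta>. if \<alpha> = \<beta> then (if \<alpha> = 0 then - (1 / c\<^sup>2) else 1) else 0)"
  using assms
  by (intro matrix_inv_unique)
    (auto simp: vec_eq_iff matrix_matrix_mult_def minkowski_def mat_def if_distrib[of "\<lambda>x. x * _"]
      sum.delta sum.delta' cong: if_cong)

lemma lower_nth: "lower c v $ \<beta> = minkowski c $ \<beta> $ \<beta> * v $ \<beta>"
  by (simp add: lower_def minkowski_def if_distrib[of "\<lambda>x. x * _"] cong: if_cong)

lemma D_lower:
  assumes "C1_on \<Omega> f" "x \<in> \<Omega>"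
  shows "D \<alpha> (\<lambda>y. lower c (f y) $ \<beta>) x = minkowski c $ \<beta> $ \<beta> * D \<alpha> f x $ \<beta>"
  unfolding lower_nth
  by (subst D_eqI[OF has_derivative_mult_right[OF bounded_linear.has_derivative[OF
        bounded_linear_vec_nth C1_on_has_derivative[OF assms]]]]) (simp add: D_def)

text \<open>The metric is diagonal, so raising an index is division by a diagonal entry. This
  matches the metric part of the pressure term with the momentum equation for \<open>U\<close>,
  which has a lowered index.\<close>

lemma sum_minkowski_inv:
  assumes "c \<noteq> 0"
  shows "(\<Sum>\<alpha>\<in>UNIV. matrix_inv (minkowski c) $ \<alpha> $ \<beta> * v \<alpha>) = v \<beta> / minkowski c $ \<beta> $ \<beta>"
  unfolding minkowski_inv[OF assms]
  by (simp add: minkowski_def if_distrib[of "\<lambda>x. x * _"] cong: if_cong)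

theorem proposition7p1:
  fixes c \<gamma> :: real
    and V V' :: "real \<Rightarrow> real"
    and \<Omega> :: "(real ^ 4) set"
    and U u J :: "real ^ 4 \<Rightarrow> real ^ 4"
    and \<rho> \<Gamma> \<mu> p :: "real ^ 4 \<Rightarrow> real"
  assumes "c > 0" and "\<gamma> \<ge> 2"
    and "V' = (\<lambda>x. x powr (\<gamma> - 1))"
    and "V = (\<lambda>x. x powr \<gamma> / \<gamma>)"
    and "open \<Omega>"
    and "\<forall>x\<in>\<Omega>. \<rho> x \<ge> 0"
    and "potential_euler_solution c V' \<Omega> U \<rho>"
    and "\<Gamma> = (\<lambda>x. 1 / sqrt (1 + 2 * V' (\<rho> x) / c\<^sup>2))"
    and "\<mu> = (\<lambda>x. \<rho> x + (\<gamma> + 1) * V (\<rho> x) / c\<^sup>2)"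
    and "u = (\<lambda>x. \<Gamma> x *\<^sub>R U x)"
    and "p = (\<lambda>x. (\<gamma> - 1) * V (\<rho> x))"
    and "J = (\<lambda>x. \<rho> x *\<^sub>R U x)"
  shows "barotropic_euler_solution c
           (\<lambda>\<alpha> x. D \<alpha> (\<lambda>y. V' (\<rho> y)) x / (1 + 2 * V' (\<rho> x) / c\<^sup>2)) \<Omega> u \<mu> p \<and>
         (\<forall>x\<in>\<Omega>. J x = (\<Gamma> x * (\<mu> x + p x / c\<^sup>2)) *\<^sub>R u x \<and>
                 \<rho> x = (\<Gamma> x)\<^sup>2 * (\<mu> x + p x / c\<^sup>2))"
proof -
  note c = assms(1) and \<gamma> = assms(2) and V' = assms(3) and V = assms(4)
  define h where "h = (\<lambda>x. \<rho> x powr (\<gamma> - 1))"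
  have h_V': "(\<lambda>y. V' (\<rho> y)) = h"
    by (simp add: V' h_def)
  have \<rho>: "\<rho> x \<ge> 0" if "x \<in> \<Omega>" for x
    using assms(6) that by auto
  then have \<rho>_image: "\<rho> ` \<Omega> \<subseteq> {0..}"
    by auto
  have h: "h x \<ge> 0" for x
    by (simp add: h_def)
  have U_C1: "C1_on \<Omega> U" and \<rho>_C1: "C1_on \<Omega> \<rho>"
    using assms(7) unfolding potential_euler_solution_def by blast+
  note compose = C1_on_compose_real[OF assms(5)] D_compose_real[OF assms(5)]

  \<comment> \<open>Powers of the density\<close>
  have powr: "C1_on \<Omega> (\<lambda>x. \<rho> x powr a)"
      "x \<in> \<Omega> \<Longrightarrow> D \<alpha> (\<lambda>x. \<rho> x powr a) x = powr_deriv a (\<rho> x) * D \<alpha> \<rho> x"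
    if "a \<ge> 1" for a x \<alpha>
    using compose[OF \<rho>_C1 has_real_derivative_powr_nonneg[OF that \<rho> \<rho>_image]
        continuous_on_powr_deriv[OF that \<rho>_image]]
    by blast+
  have h_C1: "C1_on \<Omega> h"
    unfolding h_def using \<gamma> by (intro powr) auto
  \<comment> \<open>Multiplying by \<rho> turns the power of exponent \<open>\<gamma> - 2\<close>
    into \<open>h\<close>, which keeps the identity uniform at \<rho> = 0 and at \<gamma> =
    2.\<close>
  have D_h: "\<rho> x * D \<alpha> h x = (\<gamma> - 1) * h x * D \<alpha> \<rho> x" if "x \<in> \<Omega>" for x \<alpha>
    using powr(2)[of "\<gamma> - 1" x \<alpha>] mult_powr_deriv[OF \<rho>[OF that], of "\<gamma> - 1"] \<gamma> that
    by (simp add: h_def mult.assoc[symmetric])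

  have \<rho>_h: "\<rho> x powr \<gamma> = \<rho> x * h x" if "x \<in> \<Omega>" for x
    using \<rho>[OF that] by (cases "\<rho> x = 0") (auto simp: h_def powr_diff)

  \<comment> \<open>Derivatives of the pressure and of \<mu>\<close>
  have V_der: "(V has_real_derivative t powr (\<gamma> - 1)) (at t within \<rho> ` \<Omega>)" if "t \<ge> 0" for t
    unfolding V
    using DERIV_cdivide[OF has_real_derivative_powr_nonneg[of \<gamma> t, OF _ that \<rho>_image], of \<gamma>] \<gamma>
    by (simp add: powr_deriv_def)
  have p_der: "((\<lambda>t. (\<gamma> - 1) * V t) has_real_derivative (\<gamma> - 1) * t powr (\<gamma> - 1))
      (at t within \<rho> ` \<Omega>)" if "t \<ge> 0" for t
    by (rule DERIV_cmult[OF V_der[OF that]])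
  have p_cont: "continuous_on (\<rho> ` \<Omega>) (\<lambda>t. (\<gamma> - 1) * t powr (\<gamma> - 1))"
    using \<gamma> \<rho> by (auto intro!: continuous_intros continuous_on_powr')
  have p_C1: "C1_on \<Omega> p"
    unfolding assms(11) by (rule compose(1)[OF \<rho>_C1 p_der p_cont]) (use \<rho> in auto)
  have D_p: "D \<alpha> p x = \<rho> x * D \<alpha> h x" if "x \<in> \<Omega>" for x \<alpha>
    unfolding D_h[OF that] assms(11)
    by (subst compose(2)[OF \<rho>_C1 p_der p_cont]) (use \<rho> that in \<open>auto simp: h_def\<close>)

  have \<mu>_der: "((\<lambda>t. t + (\<gamma> + 1) * V t / c\<^sup>2) has_real_derivative
      1 + (\<gamma> + 1) * t powr (\<gamma> - 1) / c\<^sup>2) (at t within \<rho> ` \<Omega>)" if "t \<ge> 0" for t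
    by (intro DERIV_add DERIV_ident DERIV_cdivide DERIV_cmult V_der that)
  have \<mu>_cont: "continuous_on (\<rho> ` \<Omega>) (\<lambda>t. 1 + (\<gamma> + 1) * t powr (\<gamma> - 1) / c\<^sup>2)"
    using \<gamma> \<rho> c by (auto intro!: continuous_intros continuous_on_powr')
  have \<mu>_C1: "C1_on \<Omega> \<mu>"
    unfolding assms(9) by (rule compose(1)[OF \<rho>_C1 \<mu>_der \<mu>_cont]) (use \<rho> in auto)
  have D_\<mu>: "D \<alpha> \<mu> x = (1 + (\<gamma> + 1) * h x / c\<^sup>2) * D \<alpha> \<rho> x" if "x \<in> \<Omega>" for x \<alpha>
    unfolding assms(9)
    by (subst compose(2)[OF \<rho>_C1 \<mu>_der \<mu>_cont]) (use \<rho> that in \<open>auto simp: h_def\<close>)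

  \<comment> \<open>The normalizing factor \<Gamma> and the field \<open>u\<close>\<close>
  define W where "W = (\<lambda>x. 1 + 2 * h x / c\<^sup>2)"
  have W: "W x > 0" for x
    using h[of x] c by (simp add: W_def add_pos_nonneg)
  have \<Gamma>_def: "\<Gamma> = (\<lambda>x. 1 / sqrt (1 + 2 * h x / c\<^sup>2))"
    by (simp add: assms(8) fun_cong[OF h_V'])
  have \<Gamma>_W: "(\<Gamma> x)\<^sup>2 = 1 / W x" for x
    using W[of x] by (simp add: \<Gamma>_def W_def power_divide)
  \<comment> \<open>\<Gamma> is differentiated as a function of \<open>h\<close> rather than of
    \<rho>: it is smooth for nonnegative arguments, and its gradient comes out in terms of
    \<open>D \<alpha> h\<close>, the quantity in the momentum equation.\<close>
  have \<Gamma>_der: "((\<lambda>t. 1 / sqrt (1 + 2 * t / c\<^sup>2)) has_real_derivative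
      - ((1 / sqrt (1 + 2 * t / c\<^sup>2)) ^ 3) / c\<^sup>2) (at t within h ` \<Omega>)" if "t \<ge> 0" for t
  proof -
    have "1 + 2 * t / c\<^sup>2 > 0"
      using that c by (simp add: add_pos_nonneg)
    then show ?thesis
      using c by (auto intro!: derivative_eq_intros simp: power3_eq_cube power2_eq_square divide_simps)
  qed
  have \<Gamma>_cont: "continuous_on (h ` \<Omega>) (\<lambda>t. - ((1 / sqrt (1 + 2 * t / c\<^sup>2)) ^ 3) / c\<^sup>2)"
    using W c by (auto intro!: continuous_intros simp: W_def less_imp_neq[symmetric])
  have \<Gamma>_C1: "C1_on \<Omega> \<Gamma>"
    unfolding \<Gamma>_def by (rule compose(1)[OF h_C1 \<Gamma>_der \<Gamma>_cont]) (rule h)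
  have D_\<Gamma>: "D \<alpha> \<Gamma> x = - (\<Gamma> x ^ 3) / c\<^sup>2 * D \<alpha> h x" if "x \<in> \<Omega>" for x \<alpha>
    unfolding \<Gamma>_def
    by (subst compose(2)[OF h_C1 \<Gamma>_der \<Gamma>_cont]) (use h that in auto)

  have u_C1: "C1_on \<Omega> u"
    unfolding assms(10) by (rule C1_on_scaleR[OF \<Gamma>_C1 U_C1])
  have D_u: "D \<alpha> (\<lambda>y. u y $ \<beta>) x
      = \<Gamma> x * D \<alpha> U x $ \<beta> - \<Gamma> x ^ 3 / c\<^sup>2 * D \<alpha> h x * U x $ \<beta>" if "x \<in> \<Omega>" for x \<alpha> \<beta>
    unfolding D_component[OF u_C1 that] unfolding assms(10)
    using D_scaleR[OF \<Gamma>_C1 U_C1 that] D_\<Gamma>[OF that] by simp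
  \<comment> \<open>The coefficients \<open>\<gamma> + 1\<close> and \<open>\<gamma> - 1\<close> of
    \<open>V\<close> add up to \<open>2 * \<gamma>\<close>, which cancels the denominator \<gamma>
    of \<open>V\<close>.\<close>
  have enthalpy: "\<mu> x + p x / c\<^sup>2 = \<rho> x * W x" if "x \<in> \<Omega>" for x
    using \<gamma> c by (simp add: assms(9,11) V W_def \<rho>_h[OF that] field_simps)

  have current: "\<rho> x = (\<Gamma> x)\<^sup>2 * (\<mu> x + p x / c\<^sup>2)" if "x \<in> \<Omega>" for x
    using W[of x] by (simp add: \<Gamma>_W enthalpy[OF that])

  \<comment> \<open>The pressure as a function of \<mu>\<close>
  have barotropic: "\<exists>P. \<forall>x\<in>\<Omega>. p x = P (\<mu> x)"
  proof -
    define M where "M = (\<lambda>t. t + (\<gamma> + 1) * V t / c\<^sup>2)"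
    have "strict_mono_on {0..} M"
    proof (rule strict_mono_onI)
      fix s t :: real
      assume "s \<in> {0..}" "t \<in> {0..}" "s < t"
      then have "V s \<le> V t"
        using \<gamma> by (simp add: V divide_right_mono powr_mono2)
      then have "(\<gamma> + 1) * V s / c\<^sup>2 \<le> (\<gamma> + 1) * V t / c\<^sup>2"
        using \<gamma> by (intro divide_right_mono mult_left_mono) auto
      with \<open>s < t\<close> show "M s < M t"
        by (simp add: M_def)
    qed
    then have "inj_on M {0..}"
      by (rule strict_mono_on_imp_inj_on)
    \<comment> \<open>By injectivity of \<open>M\<close> on the half line, \<open>inv_into\<close>
      recovers \<rho> from \<mu>; substituting it into the formula for the pressure gives the
      witness.\<close>
    then have "p x = (\<gamma> - 1) * V (inv_into {0..} M (\<mu> x))" if "x \<in> \<Omega>" for x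
      using \<rho>[OF that] inv_into_f_f[of M "{0..}" "\<rho> x"] by (simp add: assms(9,11) M_def)
    then show ?thesis
      by (intro exI[of _ "\<lambda>m. (\<gamma> - 1) * V (inv_into {0..} M m)"]) auto
  qed

  \<comment> \<open>The equations at a point: momentum, continuity, normalization\<close>
  have pointwise:
    "(\<Sum>\<alpha>\<in>UNIV. u x $ \<alpha> * D \<alpha> (\<lambda>y. u y $ \<beta>) x)
       + (\<Sum>\<alpha>\<in>UNIV. (matrix_inv (minkowski c) $ \<alpha> $ \<beta> + u x $ \<alpha> * u x $ \<beta> / c\<^sup>2)
           * (if \<mu> x + p x / c\<^sup>2 = 0 then D \<alpha> h x / W x else D \<alpha> p x / (\<mu> x + p x / c\<^sup>2))) = 0"
    "(\<Sum>\<alpha>\<in>UNIV. u x $ \<alpha> * D \<alpha> \<mu> x)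
       + (\<mu> x + p x / c\<^sup>2) * (\<Sum>\<alpha>\<in>UNIV. D \<alpha> (\<lambda>y. u y $ \<alpha>) x) = 0"
    "(\<Sum>\<alpha>\<in>UNIV. u x $ \<alpha> * lower c (u x) $ \<alpha>) = - (c\<^sup>2)"
    if x: "x \<in> \<Omega>" for x \<beta>
  proof -
    let ?Uh = "\<Sum>\<alpha>\<in>UNIV. U x $ \<alpha> * D \<alpha> h x"
    let ?U\<rho> = "\<Sum>\<alpha>\<in>UNIV. U x $ \<alpha> * D \<alpha> \<rho> x"
    let ?g = "minkowski c $ \<beta> $ \<beta>"
    have u_x: "u x $ \<alpha> = \<Gamma> x * U x $ \<alpha>" for \<alpha>
      by (simp add: assms(10))
    have g: "?g \<noteq> 0"
      using c by (simp add: minkowski_def)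
    have "(\<Sum>\<alpha>\<in>UNIV. U x $ \<alpha> * D \<alpha> (\<lambda>y. lower c (U y) $ \<beta>) x) + D \<beta> h x = 0"
      and mass: "?U\<rho> + \<rho> x * (\<Sum>\<alpha>\<in>UNIV. D \<alpha> U x $ \<alpha>) = 0"
      and norm: "(\<Sum>\<alpha>\<in>UNIV. U x $ \<alpha> * lower c (U x) $ \<alpha>) + 2 * h x = - (c\<^sup>2)"
      using assms(7) x
      unfolding potential_euler_solution_def h_V' fun_cong[OF h_V'] D_component[OF U_C1 x, symmetric]
      by blast+
    then have "?g * (\<Sum>\<alpha>\<in>UNIV. U x $ \<alpha> * D \<alpha> U x $ \<beta>) + D \<beta> h x = 0"
      by (simp add: D_lower[OF U_C1 x] sum_distrib_left mult.left_commute)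
    with g have momentum: "(\<Sum>\<alpha>\<in>UNIV. U x $ \<alpha> * D \<alpha> U x $ \<beta>) = - D \<beta> h x / ?g"
      by (simp add: field_simps eq_neg_iff_add_eq_0)

    \<comment> \<open>Both readings of the quotient agree: outside the vacuum the factor \<rho> of
      \<open>D \<alpha> p\<close> cancels against that of the enthalpy, and \<open>1 / W\<close> is
      the square of \<Gamma>.\<close>
    have quotient: "(if \<mu> x + p x / c\<^sup>2 = 0 then D \<alpha> h x / W x else D \<alpha> p x / (\<mu> x + p x / c\<^sup>2))
        = (\<Gamma> x)\<^sup>2 * D \<alpha> h x" for \<alpha>
      using W[of x] by (auto simp: enthalpy[OF x] D_p[OF x] \<Gamma>_W)
    \<comment> \<open>Differentiating \<Gamma> along \<open>u\<close> produces a multiple of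
      \<open>U x $ \<beta>\<close> that cancels exactly against the
      \<open>u x $ \<alpha> * u x $ \<beta>\<close> part of the pressure term. What remains is the
      momentum equation for \<open>U\<close>, scaled by the square of \<Gamma>.\<close>
    have "(\<Sum>\<alpha>\<in>UNIV. u x $ \<alpha> * D \<alpha> (\<lambda>y. u y $ \<beta>) x)
        = (\<Gamma> x)\<^sup>2 * (\<Sum>\<alpha>\<in>UNIV. U x $ \<alpha> * D \<alpha> U x $ \<beta>) - \<Gamma> x ^ 4 / c\<^sup>2 * U x $ \<beta> * ?Uh"
      by (simp add: D_u[OF x] u_x sum_distrib_left sum_subtractf[symmetric])
        (simp add: algebra_simps power2_eq_square power3_eq_cube power4_eq_xxxx)
    moreover have "(\<Sum>\<alpha>\<in>UNIV. (matrix_inv (minkowski c) $ \<alpha> $ \<beta> + u x $ \<alpha> * u x $ \<beta> / c\<^sup>2)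
          * ((\<Gamma> x)\<^sup>2 * D \<alpha> h x))
        = (\<Sum>\<alpha>\<in>UNIV. matrix_inv (minkowski c) $ \<alpha> $ \<beta> * ((\<Gamma> x)\<^sup>2 * D \<alpha> h x))
          + \<Gamma> x ^ 4 / c\<^sup>2 * U x $ \<beta> * ?Uh"
      by (simp add: u_x sum_distrib_left sum.distrib[symmetric])
        (simp add: algebra_simps power2_eq_square power4_eq_xxxx)
    ultimately show "(\<Sum>\<alpha>\<in>UNIV. u x $ \<alpha> * D \<alpha> (\<lambda>y. u y $ \<beta>) x)
       + (\<Sum>\<alpha>\<in>UNIV. (matrix_inv (minkowski c) $ \<alpha> $ \<beta> + u x $ \<alpha> * u x $ \<beta> / c\<^sup>2)
           * (if \<mu> x + p x / c\<^sup>2 = 0 then D \<alpha> h x / W x else D \<alpha> p x / (\<mu> x + p x / c\<^sup>2))) = 0"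
      using c unfolding quotient by (simp add: sum_minkowski_inv momentum)

    have \<Gamma>3: "\<Gamma> x ^ 3 * W x = \<Gamma> x"
      using W[of x] \<Gamma>_W[of x] by (simp add: power3_eq_cube power2_eq_square)
    have div_u: "(\<Sum>\<alpha>\<in>UNIV. D \<alpha> (\<lambda>y. u y $ \<alpha>) x)
        = \<Gamma> x * (\<Sum>\<alpha>\<in>UNIV. D \<alpha> U x $ \<alpha>) - \<Gamma> x ^ 3 / c\<^sup>2 * ?Uh"
      by (simp add: D_u[OF x] sum_distrib_left sum_subtractf sum_divide_distrib mult_ac)
    have \<rho>_Uh: "\<rho> x * ?Uh = (\<gamma> - 1) * h x * ?U\<rho>"
      by (simp add: sum_distrib_left mult.left_commute[of _ "U x $ _"] D_h[OF x])
    have \<rho>_div: "\<rho> x * (\<Sum>\<alpha>\<in>UNIV. D \<alpha> U x $ \<alpha>) = - ?U\<rho>"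
      using mass by simp
    \<comment> \<open>The factor \<rho> of the enthalpy is distributed over both terms of the
      divergence, so that \<open>\<rho>_div\<close> and \<open>\<rho>_Uh\<close> apply without any
      division by \<rho>.\<close>
    have "(\<mu> x + p x / c\<^sup>2) * (\<Sum>\<alpha>\<in>UNIV. D \<alpha> (\<lambda>y. u y $ \<alpha>) x)
        = \<Gamma> x * W x * (\<rho> x * (\<Sum>\<alpha>\<in>UNIV. D \<alpha> U x $ \<alpha>)) - (\<Gamma> x ^ 3 * W x) / c\<^sup>2 * (\<rho> x * ?Uh)"
      unfolding enthalpy[OF x] div_u by (simp add: algebra_simps)
    \<comment> \<open>\<open>W\<close> contributes \<open>2 * h x\<close> and the gradient of
      \<Gamma> contributes \<open>(\<gamma> - 1) * h x\<close>; together they give the coefficient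
      \<open>\<gamma> + 1\<close> in the derivative of \<mu> with respect to \<rho>.\<close>
    also have "\<dots> = - \<Gamma> x * (1 + (\<gamma> + 1) * h x / c\<^sup>2) * ?U\<rho>"
      unfolding \<rho>_div \<rho>_Uh \<Gamma>3 unfolding W_def using c by (simp add: field_simps)
    also have "\<dots> = - (\<Sum>\<alpha>\<in>UNIV. u x $ \<alpha> * D \<alpha> \<mu> x)"
      by (simp add: D_\<mu>[OF x] u_x sum_distrib_left sum_distrib_right mult_ac)
    finally show "(\<Sum>\<alpha>\<in>UNIV. u x $ \<alpha> * D \<alpha> \<mu> x)
       + (\<mu> x + p x / c\<^sup>2) * (\<Sum>\<alpha>\<in>UNIV. D \<alpha> (\<lambda>y. u y $ \<alpha>) x) = 0"
      by simp

    have "(\<Sum>\<alpha>\<in>UNIV. u x $ \<alpha> * lower c (u x) $ \<alpha>)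
        = (\<Gamma> x)\<^sup>2 * (\<Sum>\<alpha>\<in>UNIV. U x $ \<alpha> * lower c (U x) $ \<alpha>)"
      by (simp add: lower_nth u_x sum_distrib_left power2_eq_square mult_ac)
    \<comment> \<open>The constraint on \<open>U\<close> fixes its Minkowski square as
      \<open>- (c\<^sup>2) * W x\<close>, which is why scaling by \<Gamma> normalizes it.\<close>
    also have "(\<Sum>\<alpha>\<in>UNIV. U x $ \<alpha> * lower c (U x) $ \<alpha>) = - (c\<^sup>2) * W x"
    proof -
      have "c\<^sup>2 * W x = c\<^sup>2 + 2 * h x"
        using c by (simp add: W_def distrib_left)
      with norm show ?thesis
        by simp
    qed
    finally show "(\<Sum>\<alpha>\<in>UNIV. u x $ \<alpha> * lower c (u x) $ \<alpha>) = - (c\<^sup>2)"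
      using W[of x] by (simp add: \<Gamma>_W)
  qed

  have "J x = (\<Gamma> x * (\<mu> x + p x / c\<^sup>2)) *\<^sub>R u x" if "x \<in> \<Omega>" for x
    using current[OF that] by (simp add: assms(10,12) power2_eq_square mult_ac)
  moreover have "barotropic_euler_solution c (\<lambda>\<alpha> x. D \<alpha> h x / W x) \<Omega> u \<mu> p"
    unfolding barotropic_euler_solution_def
    by (intro conjI ballI allI u_C1 \<mu>_C1 p_C1 barotropic pointwise)
  then have "barotropic_euler_solution c
      (\<lambda>\<alpha> x. D \<alpha> (\<lambda>y. V' (\<rho> y)) x / (1 + 2 * V' (\<rho> x) / c\<^sup>2)) \<Omega> u \<mu> p"
    unfolding h_V' fun_cong[OF h_V'] W_def .
  ultimately show ?thesis
    using current by blast
qed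

end
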